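(* Let $U$ be a nonzero real $n\times m$ matrix and let $D$ be an $m\times m$ diagonal matrix with diagonal entries $(\alpha_j)_{j\leqslant m}$ (real numbers) such that $\mathrm{Ker}(D)\subset \mathrm{Ker}(U)$. Then for any $\varepsilon\in(0,1)$ there exists $\sigma\subset\Gamma_D:=\{j\leqslant m \mid \alpha_j\neq 0\}$ with $$|\sigma|\geqslant\left[(1-\varepsilon)^2\frac{\|U\|_{\mathrm{HS}}^2}{\|U\|^2}\right]$$ such that $$s_{\min}\left(U_\sigma D_\sigma^{-1}\right)>\frac{\varepsilon\,\|U\|_{\mathrm{HS}}}{\|D\|_{\mathrm{HS}}}.$$
   Context: $[x]$ denotes the integer part of $x$. $\|A\|$ is the operator norm of a matrix $A$ with respect to Euclidean norms, and $\|A\|_{\mathrm{HS}}=\sqrt{\mathrm{Tr}(AA^* )}$ is the Hilbert-Schmidt norm. For $\sigma\subset\{1,\dots,m\}$, $U_\sigma$ is the restriction of $U$ to the columns with indices in $\sigma$, i.e. $U_\sigma=UP_\sigma^t$ where $P_\sigma:\mathbb{R}^m\to\mathbb{R}^\sigma$ is the canonical coordinate projection. $D_\sigma^{-1}$ is the restricted inverse of $D$: the diagonal matrix whose diagonal entries are the inverses $1/\alpha_j$ for indices $j\in\sigma$ (and zero elsewhere). Thus $U_\sigma D_\sigma^{-1}$ is understood as the $n\times|\sigma|$ matrix with columns $Ue_j/\alpha_j$, $j\in\sigma$, where $(e_j)$ is the canonical basis of $\mathbb{R}^m$. $s_{\min}$ denotes the smallest singular value, i.e. $s_{\min}(U_\sigma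 D_\sigma^{-1})=\min\{\|U_\sigma D_\sigma^{-1}x\|_2 : x\in\mathbb{R}^\sigma,\ \|x\|_2=1\}$; for empty $\sigma$ the bound on $s_{\min}$ is vacuous. *)

theory Defs
  imports "HOL-Analysis.Analysis"
begin

definition diag_matrix :: "('m \<Rightarrow> real) \<Rightarrow> real^'m^'m" where
  "diag_matrix \<alpha> = (\<chi> i j. if i = j then \<alpha> i else 0)"

definition mat_kernel :: "real^'m^'n \<Rightarrow> (real^'m) set" where
  "mat_kernel A = {x. A *v x = 0}"

definition op_norm :: "real^'m^'n \<Rightarrow> real" where
  "op_norm A = onorm ((*v) A)"

definition hs_norm :: "real^'m^'n \<Rightarrow> real" where
  "hs_norm A = sqrt (trace (A ** transpose A))"

(* Since \<sigma> is quantified inside the theorem, R^\<sigma> cannot be a type. It is represented by its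
   isometric image in R^m under the transpose of the coordinate projection: the vectors
   supported in \<sigma>. A matrix with columns indexed by \<sigma> is accordingly an n x m matrix of which
   only the columns in \<sigma> matter. *)

definition coord_space :: "'m::finite set \<Rightarrow> (real^'m) set" where
  "coord_space \<sigma> = {x. \<forall>j. j \<notin> \<sigma> \<longrightarrow> x $ j = 0}"

definition restrict_columns :: "'m set \<Rightarrow> real^'m^'n \<Rightarrow> real^'m^'n" where
  "restrict_columns \<sigma> U = (\<chi> i j. if j \<in> \<sigma> then U $ i $ j else 0)"

definition restricted_inverse :: "'m set \<Rightarrow> real^'m^'m \<Rightarrow> real^'m^'m" where
  "restricted_inverse \<sigma> D = diag_matrix (\<lambda>j. if j \<in> \<sigma> then 1 / D $ j $ j else 0)"

(* The smallest singular value of the operator R^\<sigma> \<rightarrow> R^n given by A. For nonempty \<sigma> the infimum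
   is a minimum, see s_min_attained below; for empty \<sigma> the index set is empty and the value
   is meaningless. *)
definition s_min :: "'m set \<Rightarrow> real^'m^'n \<Rightarrow> real" where
  "s_min \<sigma> A = (INF x \<in> {x \<in> coord_space \<sigma>. norm x = 1}. norm (A *v x))"

lemma s_min_attained:
  fixes A :: "real^'m^'n"
  assumes "\<sigma> \<noteq> {}"
  shows "\<exists>x \<in> coord_space \<sigma>. norm x = 1 \<and> norm (A *v x) = s_min \<sigma> A \<and>
    (\<forall>y \<in> coord_space \<sigma>. norm y = 1 \<longrightarrow> norm (A *v x) \<le> norm (A *v y))"
proof -
  let ?S = "{x \<in> coord_space \<sigma>. norm x = 1} :: (real^'m) set"
  obtain j where j: "j \<in> \<sigma>" using assms by blast
  have "axis j 1 \<in> ?S"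
    using j by (auto simp: coord_space_def norm_axis_1) (auto simp: axis_def)
  then have ne: "?S \<noteq> {}" by blast
  have "coord_space \<sigma> = (\<Inter>j\<in>-\<sigma>. {x::real^'m. x $ j = 0})"
    by (auto simp: coord_space_def)
  moreover have "closed {x::real^'m. x $ j = 0}" for j
    by (intro closed_Collect_eq continuous_intros)
  ultimately have "closed (coord_space \<sigma> :: (real^'m) set)" by auto
  then have "compact (coord_space \<sigma> \<inter> sphere (0::real^'m) 1)"
    by (intro closed_Int_compact compact_sphere)
  moreover have "coord_space \<sigma> \<inter> sphere (0::real^'m) 1 = ?S"
    by (auto simp: sphere_def)
  ultimately have cp: "compact ?S" by simp
  have "continuous_on ?S (\<lambda>x. norm (A *v x))"
    by (intro continuous_on_norm linear_continuous_on matrix_vector_mul_bounded_linear)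
  from continuous_attains_inf[OF cp ne this]
  obtain x where x: "x \<in> ?S" "\<forall>y\<in>?S. norm (A *v x) \<le> norm (A *v y)" by blast
  have "s_min \<sigma> A = norm (A *v x)"
    unfolding s_min_def
    by (rule cInf_eq_minimum) (use x in auto)
  then show ?thesis using x by auto
qed

lemma column_restrict_times_inverse:
  fixes U :: "real^'m^'n"
  assumes "j \<in> \<sigma>"
  shows "column j (restrict_columns \<sigma> U ** restricted_inverse \<sigma> (diag_matrix \<alpha>))
    = (1 / \<alpha> j) *\<^sub>R (U *v axis j 1)"
proof -
  have "(\<Sum>k\<in>UNIV. (if k \<in> \<sigma> then U $ i $ k else 0) * (if k = j then if k \<in> \<sigma> then 1 / \<alpha> k else 0 else 0))
      = (\<Sum>k\<in>UNIV. if k = j then U $ i $ j / \<alpha> j else 0)" for i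
    using assms by (intro sum.cong) auto
  moreover have "(\<Sum>k\<in>UNIV. U $ i $ k * (if k = j then 1 else 0))
      = (\<Sum>k\<in>UNIV. if k = j then U $ i $ j else 0)" for i
    by (intro sum.cong) auto
  moreover have "restricted_inverse \<sigma> (diag_matrix \<alpha>) = diag_matrix (\<lambda>k. if k \<in> \<sigma> then 1 / \<alpha> k else 0)"
    by (simp add: restricted_inverse_def diag_matrix_def cong: if_cong)
  ultimately show ?thesis
    by (simp add: vec_eq_iff column_def matrix_matrix_mult_def restrict_columns_def
        diag_matrix_def matrix_vector_mult_def axis_def)
qed

end

theory Submission
  imports Defs
begin

text \<open>Following Spielman and Srivastava, the columns \<open>v j = U e j / \<alpha> j\<close> are selected one at a time.
  The sum \<open>A\<close> of the rank-one operators \<open>v v\<^sup>T\<close> over the selected columns is kept above a barrier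
  \<open>b\<close> on their span; the barrier drops by a fixed \<open>\<delta>\<close> in every step. Adding \<open>v\<close> produces a new
  eigenvalue above \<open>b\<close> as soon as \<open>v \<bullet> (A - b)\<^bsup>-1\<^esup> v < -1\<close>. That such a column exists, and that the
  potential \<open>Tr (U\<^sup>T (A - b)\<^bsup>-1\<^esup> U)\<close> stays below \<open>- d - \<parallel>U\<parallel>\<^sup>2 / \<delta>\<close> with \<open>d\<close> the squared
  Hilbert-Schmidt norm of \<open>D\<close>, follows by averaging over all columns with weights \<open>\<alpha>\<^sup>2\<close>. Finally,
  the lower bound of \<open>V V\<^sup>T\<close> on the span carries over to \<open>V\<^sup>T V\<close> by duality.\<close>

section \<open>Operators with a spectral gap at the barrier, and their resolvents\<close>

text \<open>The conditions force \<open>S\<close> to be the range of \<open>A\<close> and its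
  orthogonal complement to be the kernel, so every eigenvalue is 0 or exceeds \<open>b\<close>.
  Carrying \<open>S\<close> along lets all arguments run on quadratic forms, without diagonalizing
  \<open>A\<close>.\<close>

locale spectral_gap =
  fixes A :: "'a::euclidean_space \<Rightarrow> 'a" and S :: "'a set" and b :: real
  assumes linear: "linear A"
    and selfadjoint: "A x \<bullet> y = x \<bullet> A y"
    and subspace: "subspace S"
    and range: "A x \<in> S"
    and pos: "0 < b"
    and gap: "x \<in> S \<Longrightarrow> x \<noteq> 0 \<Longrightarrow> b * (x \<bullet> x) < A x \<bullet> x"

text \<open>With this sign the form of the resolvent is nonnegative on \<open>S\<close> and negative
  on the complement. The choice made by \<open>inv\<close> is harmless under
  \<open>spectral_gap\<close>, by \<open>shift_bij\<close>.\<close>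

definition resolvent :: "('a::euclidean_space \<Rightarrow> 'a) \<Rightarrow> real \<Rightarrow> 'a \<Rightarrow> 'a" where
  "resolvent A b = inv (\<lambda>x. A x - b *\<^sub>R x)"

lemma spectral_gap_mono:
  assumes "spectral_gap A S b" "0 < b'" "b' \<le> b"
  shows "spectral_gap A S b'"
proof -
  interpret spectral_gap A S b by fact
  show ?thesis
  proof (rule spectral_gap.intro)
    fix x assume "x \<in> S" "x \<noteq> 0"
    then show "b' * (x \<bullet> x) < A x \<bullet> x"
      using gap[of x] mult_right_mono[OF assms(3), of "x \<bullet> x"] inner_ge_zero[of x] by linarith
  qed (simp_all add: linear selfadjoint subspace range assms(2))
qed

context spectral_gap
begin

lemma orthogonal_imp_zero:
  assumes "\<And>s. s \<in> S \<Longrightarrow> w \<bullet> s = 0"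
  shows "A w = 0"
proof -
  have "A w \<bullet> A w = 0" using assms[OF range[of "A w"]] selfadjoint[of w "A w"] by simp
  then show ?thesis by simp
qed

lemma form_nonneg: "x \<in> S \<Longrightarrow> 0 \<le> A x \<bullet> x - b * (x \<bullet> x)"
  using gap[of x] by (cases "x = 0") auto

text \<open>An eigenvector for \<open>b\<close> would equal \<open>(1/b) *\<^sub>R A x\<close> and
  hence lie in \<open>S\<close>, which the gap excludes. In finite dimension injectivity
  suffices.\<close>

lemma shift_bij: "bij (\<lambda>x. A x - b *\<^sub>R x)"
proof -
  have lin: "linear (\<lambda>x. A x - b *\<^sub>R x)"
    by (rule linearI)
      (simp_all add: linear_add[OF linear] linear_scale[OF linear] algebra_simps)
  have "x = 0" if "A x - b *\<^sub>R x = 0" for x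
  proof -
    have e: "A x = b *\<^sub>R x" using that by simp
    then have "x = (1/b) *\<^sub>R A x" using pos by simp
    then have "x \<in> S" using range subspace by (metis subspace_scale)
    then show ?thesis using gap[of x] e by auto
  qed
  then have "inj (\<lambda>x. A x - b *\<^sub>R x)"
    using linear_injective_0[OF lin] by blast
  then show ?thesis
    using linear_injective_imp_surjective[OF lin] by (simp add: bij_def)
qed

lemma resolvent_shift: "A (resolvent A b y) - b *\<^sub>R resolvent A b y = y"
  using surj_f_inv_f[OF bij_is_surj[OF shift_bij], of y] by (simp add: resolvent_def)

lemma resolvent_eqI: "A x - b *\<^sub>R x = y \<Longrightarrow> resolvent A b y = x"
  using inv_f_f[OF bij_is_inj[OF shift_bij], of x] by (auto simp: resolvent_def)

lemma shift_selfadjoint: "(A x - b *\<^sub>R x) \<bullet> y = x \<bullet> (A y - b *\<^sub>R y)"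
  by (simp add: inner_diff_left inner_diff_right selfadjoint)

lemma resolvent_selfadjoint: "resolvent A b x \<bullet> y = x \<bullet> resolvent A b y"
  using shift_selfadjoint[of "resolvent A b x" "resolvent A b y"] by (simp add: resolvent_shift)

lemma resolvent_add: "resolvent A b (x + y) = resolvent A b x + resolvent A b y"
  using resolvent_shift[of x] resolvent_shift[of y]
  by (intro resolvent_eqI) (simp add: linear_add[OF linear] algebra_simps)

lemma resolvent_scale: "resolvent A b (c *\<^sub>R x) = c *\<^sub>R resolvent A b x"
proof (rule resolvent_eqI)
  have "A (c *\<^sub>R resolvent A b x) - b *\<^sub>R c *\<^sub>R resolvent A b x
      = c *\<^sub>R (A (resolvent A b x) - b *\<^sub>R resolvent A b x)"
    by (simp add: linear_scale[OF linear] algebra_simps)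
  then show "A (c *\<^sub>R resolvent A b x) - b *\<^sub>R c *\<^sub>R resolvent A b x = c *\<^sub>R x"
    by (simp only: resolvent_shift)
qed

lemma resolvent_in:
  assumes "s \<in> S" shows "resolvent A b s \<in> S"
proof -
  have "resolvent A b s = (1/b) *\<^sub>R (A (resolvent A b s) - s)"
    using resolvent_shift[of s] pos by (simp add: algebra_simps)
  then show ?thesis
    using range assms subspace by (metis subspace_scale subspace_diff)
qed

text \<open>Substituting \<open>s = A r - b r\<close> with \<open>r\<close> in \<open>S\<close>
  turns this into the form of \<open>A - b\<close> at \<open>r\<close>.\<close>

lemma resolvent_form_nonneg:
  assumes "s \<in> S" shows "0 \<le> resolvent A b s \<bullet> s"
proof -
  let ?r = "resolvent A b s"
  have "?r \<bullet> s = ?r \<bullet> (A ?r - b *\<^sub>R ?r)" by (simp add: resolvent_shift)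
  also have "\<dots> \<ge> 0"
    using form_nonneg[OF resolvent_in[OF assms]] by (simp add: inner_diff_right inner_commute)
  finally show ?thesis .
qed

text \<open>The resolvent preserves \<open>S\<close> and acts as \<open>-1/b\<close> on the
  complement, where \<open>A\<close> vanishes. The cross terms drop out, and only \<open>w\<close>
  contributes negatively.\<close>

lemma resolvent_form_ge:
  assumes s: "s \<in> S" and w: "\<And>x. x \<in> S \<Longrightarrow> w \<bullet> x = 0"
  shows "- (w \<bullet> w) / b \<le> resolvent A b (s + w) \<bullet> (s + w)"
proof -
  have "A w = 0" by (rule orthogonal_imp_zero[OF w])
  then have rw: "resolvent A b w = - (1/b) *\<^sub>R w"
    using pos by (intro resolvent_eqI) (simp add: linear_scale[OF linear] linear_neg[OF linear])
  have "resolvent A b s \<bullet> w = 0" using w[OF resolvent_in[OF s]] by (simp add: inner_commute)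
  then have "resolvent A b (s + w) \<bullet> (s + w) = resolvent A b s \<bullet> s - (w \<bullet> w) / b"
    using w[OF s] unfolding resolvent_add rw by (simp add: inner_add_left inner_add_right inner_diff_left inner_commute[of s w])
  then show ?thesis using resolvent_form_nonneg[OF s] by simp
qed

section \<open>Rank-one updates at a fixed barrier\<close>

text \<open>For the pencil \<open>x \<mapsto> A x + (v \<bullet> x) v - b x\<close>, writing \<open>v \<bullet> resolvent A b v = - 1 - r\<close> and
  \<open>x = s + c z\<close> with \<open>z = resolvent A b v\<close>, the quadratic form is a sum of the form at \<open>s\<close> and
  the squares \<open>(v \<bullet> s - r c)\<^sup>2 + r c\<^sup>2\<close>.\<close>

lemma rank_one_update:
  assumes q: "resolvent A b v \<bullet> v < -1"
  shows "spectral_gap (\<lambda>x. A x + (v \<bullet> x) *\<^sub>R v) (span (insert v S)) b"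
proof (rule spectral_gap.intro)
  show "linear (\<lambda>x. A x + (v \<bullet> x) *\<^sub>R v)"
    by (rule linearI)
      (simp_all add: linear_add[OF linear] linear_scale[OF linear] inner_add_right algebra_simps)
  show "(A x + (v \<bullet> x) *\<^sub>R v) \<bullet> y = x \<bullet> (A y + (v \<bullet> y) *\<^sub>R v)" for x y
    using selfadjoint[of x y] by (simp add: inner_add_left inner_add_right inner_commute[of x v])
  show "subspace (span (insert v S))" by simp
  show "A x + (v \<bullet> x) *\<^sub>R v \<in> span (insert v S)" for x
    by (intro span_add span_scale span_base) (auto simp: range)
  show "0 < b" by (rule pos)
  fix x assume x: "x \<in> span (insert v S)" "x \<noteq> 0"
  define z r where "z = resolvent A b v" and "r = - 1 - z \<bullet> v"
  have r: "r > 0" using q by (simp add: r_def z_def)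
  have Az: "A z = v + b *\<^sub>R z" using resolvent_shift[of v] by (simp add: z_def algebra_simps)
  obtain k where k: "x - k *\<^sub>R v \<in> S"
    using x(1) subspace by (auto simp: span_insert span_eq_iff[THEN iffD2])
  \<comment> \<open>Since \<open>v = A z - b z\<close>, replacing \<open>k v\<close> by
    \<open>- k b z\<close> changes \<open>x - k v\<close> only by \<open>k A z\<close>, which lies
    in \<open>S\<close>. This dictates \<open>c\<close>.\<close>
  define c s where "c = - k * b" and "s = x - c *\<^sub>R z"
  have "s = (x - k *\<^sub>R v) + k *\<^sub>R A z"
    by (simp add: s_def c_def Az algebra_simps)
  then have s: "s \<in> S"
    using k range subspace by (metis subspace_add subspace_scale)
  have xs: "x = s + c *\<^sub>R z" by (simp add: s_def)
  have zv: "z \<bullet> v = - 1 - r" "v \<bullet> z = - 1 - r" by (simp_all add: r_def inner_commute)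
  have Asz: "A s \<bullet> z = v \<bullet> s + b * (z \<bullet> s)"
    using selfadjoint[of s z] by (simp add: Az inner_add_right inner_commute)
  have "(A x + (v \<bullet> x) *\<^sub>R v) \<bullet> x - b * (x \<bullet> x)
      = (A s \<bullet> s - b * (s \<bullet> s)) + (v \<bullet> s - r * c)\<^sup>2 + r * c\<^sup>2"
    unfolding xs linear_add[OF linear] linear_scale[OF linear] Az
    by (simp add: inner_add_left inner_add_right zv Asz inner_commute[of s z] inner_commute[of s v]
        algebra_simps power2_eq_square)
  also have "\<dots> > 0"
  proof (cases "c = 0")
    case True
    then have "s \<noteq> 0" using x xs by auto
    then show ?thesis using gap[OF s] True by (simp add: add_pos_nonneg)
  next
    case False
    then have "r * c\<^sup>2 > 0" using r by simp
    then show ?thesis using form_nonneg[OF s] zero_le_power2[of "v \<bullet> s - r * c"] by linarith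
  qed
  finally show "b * (x \<bullet> x) < (A x + (v \<bullet> x) *\<^sub>R v) \<bullet> x"
    by (rule diff_gt_0_iff_gt[THEN iffD1])
qed

text \<open>The Sherman-Morrison formula as a quadratic form. The hypothesis keeps the updated shift
  invertible and the denominator nonzero.\<close>

lemma sherman_morrison:
  assumes q: "resolvent A b v \<bullet> v < -1"
  shows "resolvent (\<lambda>x. A x + (v \<bullet> x) *\<^sub>R v) b y \<bullet> y
    = resolvent A b y \<bullet> y - (resolvent A b v \<bullet> y)\<^sup>2 / (1 + resolvent A b v \<bullet> v)"
proof -
  interpret new: spectral_gap "\<lambda>x. A x + (v \<bullet> x) *\<^sub>R v" "span (insert v S)" b
    by (rule rank_one_update[OF q])
  define z k where "z = resolvent A b v" and "k = (z \<bullet> y) / (1 + z \<bullet> v)"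
  have ne: "1 + z \<bullet> v \<noteq> 0" using q by (simp add: z_def)
  have Az: "A z = v + b *\<^sub>R z" using resolvent_shift[of v] by (simp add: z_def algebra_simps)
  have Ay: "A (resolvent A b y) = y + b *\<^sub>R resolvent A b y"
    using resolvent_shift[of y] by (simp add: algebra_simps)
  have vy: "v \<bullet> resolvent A b y = z \<bullet> y" by (simp add: z_def resolvent_selfadjoint)
  \<comment> \<open>This is the coefficient of \<open>v\<close> left over when the updated shift is
    applied to the candidate \<open>resolvent A b y - k z\<close>; \<open>k\<close> is chosen to
    cancel it.\<close>
  have "z \<bullet> y - k * (z \<bullet> v) - k = 0" using ne by (simp add: k_def field_simps)
  then have "(z \<bullet> y - k * (z \<bullet> v) - k) *\<^sub>R v = 0" by simp
  then have "resolvent (\<lambda>x. A x + (v \<bullet> x) *\<^sub>R v) b y = resolvent A b y - k *\<^sub>R z"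
    by (intro new.resolvent_eqI)
      (simp add: linear_diff[OF linear] linear_scale[OF linear] Az Ay vy inner_diff_right
        inner_commute[of v z] algebra_simps)
  then show ?thesis
    by (simp add: inner_diff_left k_def z_def[symmetric] power2_eq_square)
qed

end

section \<open>Lowering the barrier\<close>

text \<open>From \<open>R - R' = \<delta> R R'\<close>, expanding the remaining \<open>u\<close> as
  \<open>(A - b) R' u + \<delta> R' u\<close> expresses the drop through \<open>R' u\<close>
  alone.\<close>

lemma resolvent_identity:
  assumes A: "spectral_gap A S b" and A': "spectral_gap A S (b - \<delta>)"
  defines "R \<equiv> resolvent A b" and "R' \<equiv> resolvent A (b - \<delta>)"
  shows "R u \<bullet> u - R' u \<bullet> u = \<delta> * (R' u \<bullet> R' u + \<delta> * (R (R' u) \<bullet> R' u))"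
proof -
  interpret A: spectral_gap A S b by fact
  interpret A': spectral_gap A S "b - \<delta>" by fact
  have u: "u = (A (R' u) - b *\<^sub>R R' u) + \<delta> *\<^sub>R R' u"
    using A'.resolvent_shift[of u] by (simp add: R'_def algebra_simps)
  have "R u = R' u + \<delta> *\<^sub>R R (R' u)"
    unfolding R_def
    by (subst u, unfold A.resolvent_add A.resolvent_scale) (simp add: A.resolvent_eqI)
  then have "R u \<bullet> u - R' u \<bullet> u = \<delta> * (R (R' u) \<bullet> u)"
    by (simp add: inner_add_left)
  also have "R (R' u) \<bullet> u = R (R' u) \<bullet> (A (R' u) - b *\<^sub>R R' u) + \<delta> * (R (R' u) \<bullet> R' u)"
    by (subst (2) u) (simp add: inner_add_right)
  also have "R (R' u) \<bullet> (A (R' u) - b *\<^sub>R R' u) = R' u \<bullet> R' u"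
    by (simp add: R_def A.resolvent_selfadjoint A.resolvent_eqI)
  finally show ?thesis .
qed

text \<open>This is the inequality to be averaged in \<open>barrier_step\<close>. With \<Delta> the
  drop of the potential, the bound on it reduces the claim to
  \<open>- L \<delta> E < \<Delta>^2\<close>. Here \<open>E\<close> can be negative only through the
  components of \<open>R' (u j)\<close> orthogonal to \<open>S\<close>, whose total squared norm
  \<open>W\<close> also bounds \<Delta> from below.\<close>

lemma barrier_gain:
  assumes A: "spectral_gap A S b" and \<delta>: "0 < \<delta>" "\<delta> < b" and L: "0 < L" and d: "0 < d"
    and \<Phi>: "(\<Sum>j\<in>J. resolvent A b (u j) \<bullet> u j) \<le> - d - L / \<delta>"
  defines "R' \<equiv> resolvent A (b - \<delta>)"
  shows "L * (\<Sum>j\<in>J. R' (u j) \<bullet> R' (u j))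
    < ((\<Sum>j\<in>J. resolvent A b (u j) \<bullet> u j) - (\<Sum>j\<in>J. R' (u j) \<bullet> u j))
      * (- d - (\<Sum>j\<in>J. R' (u j) \<bullet> u j))"
    and "0 < (\<Sum>j\<in>J. resolvent A b (u j) \<bullet> u j) - (\<Sum>j\<in>J. R' (u j) \<bullet> u j)"
proof -
  have A': "spectral_gap A S (b - \<delta>)" by (rule spectral_gap_mono[OF A]) (use \<delta> in auto)
  interpret A: spectral_gap A S b by fact
  interpret A': spectral_gap A S "b - \<delta>" by fact
  define b' R where "b' = b - \<delta>" and "R = resolvent A b"
  have b: "0 < b'" "0 < b" using \<delta> by (auto simp: b'_def)
  \<comment> \<open>\<open>P\<close> will be the orthogonal projection onto the complement of
    \<open>S\<close>.\<close>
  have "\<forall>y. \<exists>w. y - w \<in> S \<and> (\<forall>x\<in>S. w \<bullet> x = 0)"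
  proof
    fix y
    obtain s w where "s \<in> span S" "\<And>x. x \<in> span S \<Longrightarrow> orthogonal w x" "y = s + w"
      using orthogonal_subspace_decomp_exists[of S y] by metis
    then show "\<exists>w. y - w \<in> S \<and> (\<forall>x\<in>S. w \<bullet> x = 0)"
      using A.subspace by (auto simp: span_eq_iff[THEN iffD2] orthogonal_def intro!: exI[of _ w])
  qed
  then obtain P where P: "\<And>y. y - P y \<in> S" "\<And>y x. x \<in> S \<Longrightarrow> P y \<bullet> x = 0" by metis
  define z where "z j = R' (u j)" for j
  define E Z W where "E = (\<Sum>j\<in>J. R (z j) \<bullet> z j)" and "Z = (\<Sum>j\<in>J. z j \<bullet> z j)"
    and "W = (\<Sum>j\<in>J. P (z j) \<bullet> P (z j))"
  define \<Phi>0 \<Phi>1 where "\<Phi>0 = (\<Sum>j\<in>J. R (u j) \<bullet> u j)" and "\<Phi>1 = (\<Sum>j\<in>J. R' (u j) \<bullet> u j)"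
  define \<Delta> where "\<Delta> = \<Phi>0 - \<Phi>1"
  have E: "- W / b \<le> E"
    unfolding W_def E_def R_def sum_negf[symmetric] sum_divide_distrib
  proof (rule sum_mono)
    fix j
    show "- (P (z j) \<bullet> P (z j)) / b \<le> resolvent A b (z j) \<bullet> z j"
      using A.resolvent_form_ge[OF P(1)[of "z j"] P(2)[where y = "z j"]] by simp
  qed
  have Z: "W \<le> Z"
    unfolding W_def Z_def
  proof (rule sum_mono)
    fix j
    have "z j \<bullet> z j = (z j - P (z j)) \<bullet> (z j - P (z j)) + 2 * (P (z j) \<bullet> (z j - P (z j)))
        + P (z j) \<bullet> P (z j)"
      by (simp add: algebra_simps inner_commute)
    then show "P (z j) \<bullet> P (z j) \<le> z j \<bullet> z j" using P by simp
  qed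
  \<comment> \<open>The component of \<open>u j\<close> orthogonal to \<open>S\<close> is
    \<open>- b' P (z j)\<close>. So a very negative potential forces \<open>W\<close> to be large,
    quantified in \<open>LW\<close>.\<close>
  have "- (b'\<^sup>2 * W) / b \<le> \<Phi>0"
    unfolding W_def \<Phi>0_def R_def sum_distrib_left sum_negf[symmetric] sum_divide_distrib
  proof (rule sum_mono)
    fix j
    let ?s = "z j - P (z j)" and ?w = "- b' *\<^sub>R P (z j)"
    have "A (P (z j)) = 0" by (rule A.orthogonal_imp_zero) (rule P(2))
    then have "u j = (A ?s - b' *\<^sub>R ?s) + ?w"
      using A'.resolvent_shift[of "u j"]
      by (simp add: z_def R'_def b'_def linear_diff[OF A.linear] algebra_simps)
    moreover have "A ?s - b' *\<^sub>R ?s \<in> S"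
      by (intro subspace_diff subspace_scale A.subspace A.range P(1))
    moreover have "?w \<bullet> x = 0" if "x \<in> S" for x using P(2)[OF that] by simp
    ultimately have "- (?w \<bullet> ?w) / b \<le> resolvent A b (u j) \<bullet> u j"
      using A.resolvent_form_ge[of "A ?s - b' *\<^sub>R ?s" ?w] by simp
    then show "- (b'\<^sup>2 * (P (z j) \<bullet> P (z j))) / b \<le> resolvent A b (u j) \<bullet> u j"
      by (simp add: power2_eq_square mult.assoc)
  qed
  moreover have \<Phi>': "\<Phi>0 \<le> - d - L / \<delta>" using \<Phi> by (simp add: \<Phi>0_def R_def)
  ultimately have "L / \<delta> < b'\<^sup>2 * W / b" using d by linarith
  then have LW: "L * b < \<delta> * b'\<^sup>2 * W" using b \<delta> by (simp add: field_simps)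
  moreover have "0 < L * b" using L b by simp
  ultimately have "0 < (\<delta> * b'\<^sup>2) * W" by linarith
  moreover have "0 < \<delta> * b'\<^sup>2" using b \<delta> by simp
  ultimately have W: "0 < W" by (rule zero_less_mult_pos)
  have \<Delta>: "\<Delta> = \<delta> * (Z + \<delta> * E)"
    unfolding \<Delta>_def \<Phi>0_def \<Phi>1_def Z_def E_def R_def R'_def z_def
    by (simp only: sum_subtractf[symmetric] resolvent_identity[OF A A'] sum_distrib_left
        sum.distrib[symmetric])
  \<comment> \<open>As \<open>b' / b = 1 - \<delta> / b\<close>, the lower bounds on
    \<open>Z\<close> and \<open>E\<close> combine exactly.\<close>
  have "W * b' / b = W + \<delta> * (- W / b)" using b by (simp add: b'_def field_simps)
  also have "\<dots> \<le> Z + \<delta> * E" using E Z \<delta> by (intro add_mono mult_left_mono) auto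
  finally have \<Delta>_ge: "\<delta> * (W * b' / b) \<le> \<Delta>"
    unfolding \<Delta> using \<delta> by (intro mult_left_mono) auto
  have pos: "0 < \<delta> * (W * b' / b)" using W b \<delta> by simp
  with \<Delta>_ge have \<Delta>_pos: "0 < \<Delta>" by linarith
  then show "0 < (\<Sum>j\<in>J. resolvent A b (u j) \<bullet> u j) - (\<Sum>j\<in>J. R' (u j) \<bullet> u j)"
    by (simp add: \<Delta>_def \<Phi>0_def \<Phi>1_def R_def)
  \<comment> \<open>\<open>LW\<close> trades \<open>L b\<close> for a second factor
    \<open>W\<close>, which makes the bound a square comparable with
    \<open>\<Delta>^2\<close>.\<close>
  have "L * \<delta> * (- E) \<le> L * \<delta> * (W / b)"
    using E L \<delta> by (intro mult_left_mono) auto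
  also have "\<dots> = (L * b) * (\<delta> * W / b\<^sup>2)" using b by (simp add: field_simps power2_eq_square)
  also have "\<dots> < (\<delta> * b'\<^sup>2 * W) * (\<delta> * W / b\<^sup>2)"
    using LW W b \<delta> by (intro mult_strict_right_mono) auto
  also have "\<dots> = (\<delta> * (W * b' / b))\<^sup>2" by (simp add: power2_eq_square field_simps)
  also have "\<dots> \<le> \<Delta>\<^sup>2" using \<Delta>_ge pos by (intro power_mono) auto
  finally have "- (L * \<delta> * E) < \<Delta>\<^sup>2" by simp
  moreover have "\<Delta> * (L / \<delta>) = L * Z + L * \<delta> * E"
    unfolding \<Delta> using \<delta> by (simp add: algebra_simps)
  ultimately have "L * Z < \<Delta> * (L / \<delta>) + \<Delta>\<^sup>2" by linarith
  also have "\<dots> = \<Delta> * (L / \<delta> + \<Delta>)" by (simp add: power2_eq_square algebra_simps)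
  also have "\<dots> \<le> \<Delta> * (- d - \<Phi>1)"
    using \<Phi>' \<Delta>_pos by (intro mult_left_mono) (auto simp: \<Delta>_def)
  finally show "L * (\<Sum>j\<in>J. R' (u j) \<bullet> R' (u j))
    < ((\<Sum>j\<in>J. resolvent A b (u j) \<bullet> u j) - (\<Sum>j\<in>J. R' (u j) \<bullet> u j))
      * (- d - (\<Sum>j\<in>J. R' (u j) \<bullet> u j))"
    by (simp add: \<Delta>_def \<Phi>0_def \<Phi>1_def Z_def z_def R_def)
qed

section \<open>Selection of the columns\<close>

text \<open>In the averaging, columns with \<open>\<alpha> j = 0\<close> contribute \<open>0\<close> to both sides, so a strict
  inequality for some \<open>j\<close> forces \<open>\<alpha> j \<noteq> 0\<close>.\<close>

lemma barrier_step:
  fixes u :: "'i \<Rightarrow> 'a::euclidean_space" and \<alpha> :: "'i \<Rightarrow> real"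
  assumes A: "spectral_gap A S b" and \<delta>: "0 < \<delta>" "\<delta> < b" and L: "0 < L"
    and d: "0 < (\<Sum>j\<in>J. (\<alpha> j)\<^sup>2)"
    and ker: "\<And>j. j \<in> J \<Longrightarrow> \<alpha> j = 0 \<Longrightarrow> u j = 0"
    and bound: "\<And>x. (\<Sum>j\<in>J. (x \<bullet> u j)\<^sup>2) \<le> L * (x \<bullet> x)"
    and \<Phi>: "(\<Sum>j\<in>J. resolvent A b (u j) \<bullet> u j) \<le> - (\<Sum>j\<in>J. (\<alpha> j)\<^sup>2) - L / \<delta>"
  obtains j v where "j \<in> J" "\<alpha> j \<noteq> 0" "v = (1 / \<alpha> j) *\<^sub>R u j" "v \<notin> S"
    "spectral_gap (\<lambda>x. A x + (v \<bullet> x) *\<^sub>R v) (span (insert v S)) (b - \<delta>)"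
    "(\<Sum>j\<in>J. resolvent (\<lambda>x. A x + (v \<bullet> x) *\<^sub>R v) (b - \<delta>) (u j) \<bullet> u j)
      \<le> - (\<Sum>j\<in>J. (\<alpha> j)\<^sup>2) - L / \<delta>"
proof -
  have A': "spectral_gap A S (b - \<delta>)" by (rule spectral_gap_mono[OF A]) (use \<delta> in auto)
  interpret A': spectral_gap A S "b - \<delta>" by fact
  define R' where "R' = resolvent A (b - \<delta>)"
  define \<Delta> where "\<Delta> = (\<Sum>j\<in>J. resolvent A b (u j) \<bullet> u j) - (\<Sum>j\<in>J. R' (u j) \<bullet> u j)"
  note gain = barrier_gain[OF A \<delta> L d \<Phi>, folded R'_def, folded \<Delta>_def]
  \<comment> \<open>Apply \<open>bound\<close> at each \<open>R' (u j)\<close> and distribute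
    \<open>- d\<close> as the sum of the \<open>- \<alpha>^2\<close>. A strict inequality between
    the sums must then hold at some index.\<close>
  have "(\<Sum>j\<in>J. \<Sum>i\<in>J. (R' (u j) \<bullet> u i)\<^sup>2) \<le> L * (\<Sum>j\<in>J. R' (u j) \<bullet> R' (u j))"
    unfolding sum_distrib_left by (intro sum_mono bound)
  also have "\<dots> < (\<Sum>j\<in>J. \<Delta> * (- (\<alpha> j)\<^sup>2 - R' (u j) \<bullet> u j))"
    using gain(1) by (simp add: sum_subtractf sum_negf flip: sum_distrib_left)
  finally obtain j where j: "j \<in> J"
      "(\<Sum>i\<in>J. (R' (u j) \<bullet> u i)\<^sup>2) < \<Delta> * (- (\<alpha> j)\<^sup>2 - R' (u j) \<bullet> u j)"
    by (meson not_le sum_mono)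
  have \<alpha>: "\<alpha> j \<noteq> 0"
    using j(2) ker[OF j(1)] sum_nonneg[of J "\<lambda>i. (R' (u j) \<bullet> u i)\<^sup>2"] by auto
  define v where "v = (1 / \<alpha> j) *\<^sub>R u j"
  have uv: "u j = \<alpha> j *\<^sub>R v" using \<alpha> by (simp add: v_def)
  have "(\<alpha> j)\<^sup>2 * (\<Sum>i\<in>J. (R' v \<bullet> u i)\<^sup>2) < (\<alpha> j)\<^sup>2 * (\<Delta> * (- 1 - R' v \<bullet> v))"
    using j(2) unfolding uv R'_def A'.resolvent_scale
    by (simp add: power_mult_distrib power2_eq_square algebra_simps flip: sum_distrib_left)
  then have v: "(\<Sum>i\<in>J. (R' v \<bullet> u i)\<^sup>2) < \<Delta> * (- 1 - R' v \<bullet> v)"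
    using \<alpha> by simp
  then have "0 < \<Delta> * (- 1 - R' v \<bullet> v)"
    using sum_nonneg[of J "\<lambda>i. (R' v \<bullet> u i)\<^sup>2"] by (auto intro: le_less_trans)
  then have q: "R' v \<bullet> v < - 1"
    using gain(2) by (simp add: zero_less_mult_iff)
  have "v \<notin> S" using A'.resolvent_form_nonneg[of v] q by (auto simp: R'_def)
  moreover have "(\<Sum>i\<in>J. resolvent (\<lambda>x. A x + (v \<bullet> x) *\<^sub>R v) (b - \<delta>) (u i) \<bullet> u i)
      \<le> - (\<Sum>j\<in>J. (\<alpha> j)\<^sup>2) - L / \<delta>"
  proof -
    have "(\<Sum>i\<in>J. resolvent (\<lambda>x. A x + (v \<bullet> x) *\<^sub>R v) (b - \<delta>) (u i) \<bullet> u i)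
        = (\<Sum>i\<in>J. R' (u i) \<bullet> u i) - (\<Sum>i\<in>J. (R' v \<bullet> u i)\<^sup>2) / (1 + R' v \<bullet> v)"
      using A'.sherman_morrison[OF q[unfolded R'_def]]
      by (simp add: R'_def sum_subtractf sum_divide_distrib)
    \<comment> \<open>Lowering the barrier decreases the potential by \<Delta>, and the rank-one
      update gives back at most \<Delta>, so the invariant survives.\<close>
    also have "- ((\<Sum>i\<in>J. (R' v \<bullet> u i)\<^sup>2) / (1 + R' v \<bullet> v)) \<le> \<Delta>"
      using v q by (simp add: field_simps)
    then have "(\<Sum>i\<in>J. R' (u i) \<bullet> u i) - (\<Sum>i\<in>J. (R' v \<bullet> u i)\<^sup>2) / (1 + R' v \<bullet> v)
        \<le> (\<Sum>j\<in>J. resolvent A b (u j) \<bullet> u j)"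
      by (simp add: \<Delta>_def)
    finally show ?thesis using \<Phi> by linarith
  qed
  ultimately show ?thesis
    using that[OF j(1) \<alpha> v_def] A'.rank_one_update[OF q[unfolded R'_def]] by blast
qed

text \<open>Induction on \<open>k\<close>, with the potential bound as the invariant that feeds
  \<open>barrier_step\<close>. The last conjunct encodes linear independence of the selected vectors
  as solvability of the dual system inside \<open>S\<close>, the form used by the duality
  argument.\<close>

lemma barrier_selection:
  fixes u :: "'i \<Rightarrow> 'a::euclidean_space" and \<alpha> :: "'i \<Rightarrow> real" and \<delta> b :: real and k :: nat
  assumes J: "finite J" and \<delta>: "0 < \<delta>" and L: "0 < L" and d: "0 < (\<Sum>j\<in>J. (\<alpha> j)\<^sup>2)"
    and ker: "\<And>j. j \<in> J \<Longrightarrow> \<alpha> j = 0 \<Longrightarrow> u j = 0"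
    and bound: "\<And>x. (\<Sum>j\<in>J. (x \<bullet> u j)\<^sup>2) \<le> L * (x \<bullet> x)"
    and b: "k * \<delta> < b" "b * ((\<Sum>j\<in>J. (\<alpha> j)\<^sup>2) + L / \<delta>) \<le> (\<Sum>j\<in>J. u j \<bullet> u j)"
  defines "v \<equiv> \<lambda>j. (1 / \<alpha> j) *\<^sub>R u j"
  shows "\<exists>\<sigma> S. \<sigma> \<subseteq> {j\<in>J. \<alpha> j \<noteq> 0} \<and> card \<sigma> = k \<and> v ` \<sigma> \<subseteq> S
    \<and> spectral_gap (\<lambda>x. \<Sum>j\<in>\<sigma>. (v j \<bullet> x) *\<^sub>R v j) S (b - k * \<delta>)
    \<and> (\<Sum>j\<in>J. resolvent (\<lambda>x. \<Sum>j\<in>\<sigma>. (v j \<bullet> x) *\<^sub>R v j) (b - k * \<delta>) (u j) \<bullet> u j)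
      \<le> - (\<Sum>j\<in>J. (\<alpha> j)\<^sup>2) - L / \<delta>
    \<and> (\<forall>c. \<exists>x\<in>S. \<forall>j\<in>\<sigma>. v j \<bullet> x = c j)"
  using b(1)
proof (induction k)
  case 0
  then have pos: "0 < b" by simp
  \<comment> \<open>For the zero operator the resolvent is \<open>-1/b\<close>, so the initial
    potential bound is the second inequality of \<open>b\<close> rearranged.\<close>
  interpret zero: spectral_gap "\<lambda>x. 0" "{0::'a}" b
    by unfold_locales (use pos in \<open>auto simp: linear_zero subspace_single_0\<close>)
  have "resolvent (\<lambda>x. 0) b y = - (1 / b) *\<^sub>R y" for y :: 'a
    using pos by (intro zero.resolvent_eqI) simp
  then have "(\<Sum>j\<in>J. resolvent (\<lambda>x. 0) b (u j) \<bullet> u j) = - ((\<Sum>j\<in>J. u j \<bullet> u j) / b)"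
    by (simp add: sum_negf sum_divide_distrib)
  also have "(\<Sum>j\<in>J. (\<alpha> j)\<^sup>2) + L / \<delta> \<le> (\<Sum>j\<in>J. u j \<bullet> u j) / b"
    using b(2) pos by (simp only: pos_le_divide_eq mult.commute)
  then have "- ((\<Sum>j\<in>J. u j \<bullet> u j) / b) \<le> - (\<Sum>j\<in>J. (\<alpha> j)\<^sup>2) - L / \<delta>" by linarith
  finally show ?case
    by (intro exI[of _ "{}"] exI[of _ "{0}"]) (use zero.spectral_gap_axioms in auto)
next
  case (Suc k)
  then have "k * \<delta> < b" "\<delta> < b - k * \<delta>" using \<delta> by (simp_all add: algebra_simps)
  then obtain \<sigma> S where \<sigma>: "\<sigma> \<subseteq> {j\<in>J. \<alpha> j \<noteq> 0}" "card \<sigma> = k" "v ` \<sigma> \<subseteq> S"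
    and sgap: "spectral_gap (\<lambda>x. \<Sum>j\<in>\<sigma>. (v j \<bullet> x) *\<^sub>R v j) S (b - k * \<delta>)"
    and \<Phi>: "(\<Sum>j\<in>J. resolvent (\<lambda>x. \<Sum>j\<in>\<sigma>. (v j \<bullet> x) *\<^sub>R v j) (b - k * \<delta>) (u j) \<bullet> u j)
      \<le> - (\<Sum>j\<in>J. (\<alpha> j)\<^sup>2) - L / \<delta>"
    and dual: "\<And>c. \<exists>x\<in>S. \<forall>j\<in>\<sigma>. v j \<bullet> x = c j"
    using Suc.IH by blast
  interpret spectral_gap "\<lambda>x. \<Sum>j\<in>\<sigma>. (v j \<bullet> x) *\<^sub>R v j" S "b - k * \<delta>" by fact
  obtain j where j: "j \<in> J" "\<alpha> j \<noteq> 0" "v j \<notin> S"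
    and gap': "spectral_gap (\<lambda>x. (\<Sum>j\<in>\<sigma>. (v j \<bullet> x) *\<^sub>R v j) + (v j \<bullet> x) *\<^sub>R v j)
      (span (insert (v j) S)) (b - k * \<delta> - \<delta>)"
    and \<Phi>': "(\<Sum>i\<in>J. resolvent (\<lambda>x. (\<Sum>j\<in>\<sigma>. (v j \<bullet> x) *\<^sub>R v j) + (v j \<bullet> x) *\<^sub>R v j)
      (b - k * \<delta> - \<delta>) (u i) \<bullet> u i) \<le> - (\<Sum>j\<in>J. (\<alpha> j)\<^sup>2) - L / \<delta>"
    by (rule barrier_step[OF sgap \<delta> \<open>\<delta> < b - k * \<delta>\<close> L d ker bound \<Phi>]) (auto simp: v_def)
  have fin: "finite \<sigma>" using \<sigma>(1) J by (auto intro: finite_subset)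
  have notin: "j \<notin> \<sigma>" using j(3) \<sigma>(3) by auto
  have eq: "(\<lambda>x. \<Sum>j\<in>insert j \<sigma>. (v j \<bullet> x) *\<^sub>R v j)
      = (\<lambda>x. (\<Sum>j\<in>\<sigma>. (v j \<bullet> x) *\<^sub>R v j) + (v j \<bullet> x) *\<^sub>R v j)"
    using fin notin by (simp add: add.commute)
  have b_eq: "b - real (Suc k) * \<delta> = b - k * \<delta> - \<delta>" by (simp add: algebra_simps)
  \<comment> \<open>\<open>w\<close> is orthogonal to all earlier vectors but not to
    \<open>v j\<close>. Adding a multiple of it to a dual solution adjusts the new equation and
    preserves the old ones.\<close>
  obtain s w where sw: "s \<in> S" "\<And>x. x \<in> S \<Longrightarrow> w \<bullet> x = 0" "v j = s + w"
    using orthogonal_subspace_decomp_exists[of S "v j"] subspace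
    by (metis orthogonal_def span_eq_iff)
  have w: "w \<noteq> 0" using sw j(3) by auto
  have vw: "v j \<bullet> w = w \<bullet> w" using sw(2)[OF sw(1)] by (simp add: sw(3) inner_add_left inner_commute[of s w])
  have w_in: "w \<in> span (insert (v j) S)"
    using span_diff[OF span_base[of "v j"] span_base[of s], of "insert (v j) S"] sw(1,3) by simp
  have "\<exists>x\<in>span (insert (v j) S). \<forall>i\<in>insert j \<sigma>. v i \<bullet> x = c i" for c
  proof -
    obtain x where x: "x \<in> S" "\<forall>i\<in>\<sigma>. v i \<bullet> x = c i" using dual by blast
    let ?y = "x + ((c j - v j \<bullet> x) / (w \<bullet> w)) *\<^sub>R w"
    have "v j \<bullet> ?y = c j" using w by (simp add: inner_add_right vw)
    moreover have "v i \<bullet> ?y = c i" if "i \<in> \<sigma>" for i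
      using x(2) that sw(2)[of "v i"] \<sigma>(3) by (auto simp: inner_add_right inner_commute)
    moreover have "?y \<in> span (insert (v j) S)"
      using x(1) w_in by (intro span_add span_scale) (auto intro: span_base)
    ultimately show ?thesis by (intro bexI[of _ ?y]) auto
  qed
  moreover have "v ` insert j \<sigma> \<subseteq> span (insert (v j) S)"
    using \<sigma>(3) by (auto intro: span_base)
  ultimately show ?case
    using \<sigma> j fin notin gap' \<Phi>'
    by (intro exI[of _ "insert j \<sigma>"] exI[of _ "span (insert (v j) S)"])
      (simp only: eq b_eq, simp)
qed

section \<open>Duality between the two Gram operators\<close>

text \<open>Let \<open>y\<close> be the synthesized vector. Then \<open>y = A x\<close> for the
  frame operator \<open>A\<close>, and \<open>y \<bullet> x = 1\<close>. The gap gives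
  \<open>b |x|^2 < 1\<close>, while Cauchy-Schwarz gives \<open>1 \<le> |y| |x|\<close>.\<close>

lemma synthesis_lower_bound:
  fixes v :: "'i \<Rightarrow> 'a::euclidean_space" and c :: "'i \<Rightarrow> real"
  assumes gap: "spectral_gap (\<lambda>x. \<Sum>j\<in>\<sigma>. (v j \<bullet> x) *\<^sub>R v j) S b"
    and x: "x \<in> S" "\<And>j. j \<in> \<sigma> \<Longrightarrow> v j \<bullet> x = c j"
    and c: "(\<Sum>j\<in>\<sigma>. (c j)\<^sup>2) = 1"
  shows "sqrt b < norm (\<Sum>j\<in>\<sigma>. c j *\<^sub>R v j)"
proof -
  interpret spectral_gap "\<lambda>x. \<Sum>j\<in>\<sigma>. (v j \<bullet> x) *\<^sub>R v j" S b by fact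
  let ?y = "\<Sum>j\<in>\<sigma>. c j *\<^sub>R v j"
  have eq: "(\<Sum>j\<in>\<sigma>. (v j \<bullet> x) *\<^sub>R v j) = ?y" using x(2) by (intro sum.cong) auto
  have one: "?y \<bullet> x = 1"
    using c x(2) by (simp add: inner_sum_left power2_eq_square)
  then have "x \<noteq> 0" by auto
  then have "b * (norm x)\<^sup>2 < 1" using gap[OF x(1)] eq one by (simp add: power2_norm_eq_inner)
  then have "sqrt b * norm x < 1"
    using pos by (metis real_sqrt_less_mono real_sqrt_mult real_sqrt_abs real_sqrt_one abs_norm_cancel)
  also have "1 \<le> norm ?y * norm x"
    using norm_cauchy_schwarz[of ?y x] one by simp
  finally show ?thesis using \<open>x \<noteq> 0\<close> by simp
qed

section \<open>Matrix norms in terms of columns\<close>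

lemma hs_norm_eq: "hs_norm (M :: real^'m^'n) = sqrt (\<Sum>j\<in>UNIV. column j M \<bullet> column j M)"
proof -
  have "trace (M ** transpose M) = (\<Sum>i\<in>UNIV. \<Sum>j\<in>UNIV. (M $ i $ j)\<^sup>2)"
    by (simp add: trace_def matrix_matrix_mult_def transpose_def power2_eq_square)
  also have "\<dots> = (\<Sum>j\<in>UNIV. \<Sum>i\<in>UNIV. (M $ i $ j)\<^sup>2)" by (rule sum.swap)
  finally show ?thesis
    by (simp add: hs_norm_def column_def inner_vec_def power2_eq_square)
qed

text \<open>The left side is \<open>|y|^2\<close> for \<open>y\<close> the transpose of
  \<open>M\<close> applied to \<open>x\<close>. It equals \<open>x \<bullet> M y\<close>, which is
  at most \<open>|x| |M| |y|\<close>; cancel \<open>|y|\<close>.\<close>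

lemma op_norm_transpose_bound:
  fixes M :: "real^'m^'n"
  shows "(\<Sum>j\<in>UNIV. (x \<bullet> column j M)\<^sup>2) \<le> (op_norm M)\<^sup>2 * (x \<bullet> x)"
proof -
  define y where "y = transpose M *v x"
  have y: "y $ j = x \<bullet> column j M" for j
    by (simp add: y_def matrix_vector_mult_def transpose_def column_def inner_vec_def mult.commute)
  have "norm y * norm y = x \<bullet> (M *v y)"
    unfolding y_def by (metis dot_lmul_matrix power2_eq_square power2_norm_eq_inner transpose_matrix_vector)
  also have "\<dots> \<le> norm x * norm (M *v y)" by (rule norm_cauchy_schwarz)
  also have "\<dots> \<le> norm x * (op_norm M * norm y)"
    unfolding op_norm_def
    by (intro mult_left_mono onorm matrix_vector_mul_bounded_linear) auto
  finally have "norm y \<le> op_norm M * norm x"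
    using onorm_pos_le[OF matrix_vector_mul_bounded_linear, of M]
    by (cases "norm y = 0") (auto simp: op_norm_def mult.commute mult.left_commute)
  then have "(norm y)\<^sup>2 \<le> (op_norm M)\<^sup>2 * (norm x)\<^sup>2"
    by (metis norm_ge_zero power_mono power_mult_distrib)
  then show ?thesis
    unfolding power2_norm_eq_inner inner_vec_def[of y] by (simp add: y power2_eq_square)
qed

section \<open>Choice of the parameters and conclusion\<close>

theorem theorem1p1:
  fixes U :: "real^'m^'n" and D :: "real^'m^'m" and \<alpha> :: "'m \<Rightarrow> real" and \<epsilon> :: real
  assumes "U \<noteq> 0"
    and "D = diag_matrix \<alpha>"
    and "mat_kernel D \<subseteq> mat_kernel U"
    and "0 < \<epsilon>" and "\<epsilon> < 1"
  shows "\<exists>\<sigma> \<subseteq> {j. \<alpha> j \<noteq> 0}.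
    int (card \<sigma>) \<ge> \<lfloor>(1 - \<epsilon>)\<^sup>2 * ((hs_norm U)\<^sup>2 / (op_norm U)\<^sup>2)\<rfloor> \<and>
    (\<sigma> \<noteq> {} \<longrightarrow>
      s_min \<sigma> (restrict_columns \<sigma> U ** restricted_inverse \<sigma> D) > \<epsilon> * hs_norm U / hs_norm D)"
proof -
  define h L d where "h = (hs_norm U)\<^sup>2" and "L = (op_norm U)\<^sup>2" and "d = (\<Sum>j\<in>UNIV. (\<alpha> j)\<^sup>2)"
  define u where "u j = column j U" for j
  \<comment> \<open>The kernel inclusion is needed only at the basis vectors killed by
    \<open>D\<close>.\<close>
  have ker: "u j = 0" if "\<alpha> j = 0" for j
  proof -
    have "D *v axis j 1 = 0"
      using that by (auto simp: matrix_vector_mult_basis assms(2) vec_eq_iff column_def diag_matrix_def)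
    then have "U *v axis j 1 = 0" using assms(3) by (auto simp: mat_kernel_def)
    then show ?thesis by (simp add: u_def matrix_vector_mult_basis)
  qed
  have bound: "(\<Sum>j\<in>UNIV. (x \<bullet> u j)\<^sup>2) \<le> L * (x \<bullet> x)" for x
    unfolding u_def L_def by (rule op_norm_transpose_bound)
  have h: "h = (\<Sum>j\<in>UNIV. u j \<bullet> u j)" by (simp add: h_def hs_norm_eq u_def sum_nonneg)
  obtain j0 where j0: "u j0 \<noteq> 0"
    using assms(1) by (auto simp: vec_eq_iff u_def column_def)
  then have "0 < u j0 \<bullet> u j0" by simp
  also have "\<dots> \<le> h" unfolding h by (rule member_le_sum) auto
  finally have h_pos: "0 < h" .
  have "0 < (\<alpha> j0)\<^sup>2" using ker[of j0] j0 by auto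
  also have "\<dots> \<le> d" unfolding d_def by (rule member_le_sum) auto
  finally have d_pos: "0 < d" .
  have "(u j0 \<bullet> u j0)\<^sup>2 \<le> (\<Sum>j\<in>UNIV. (u j0 \<bullet> u j)\<^sup>2)" by (rule member_le_sum) auto
  also have "\<dots> \<le> L * (u j0 \<bullet> u j0)" by (rule bound)
  finally have "L \<noteq> 0" using j0 by auto
  then have L_pos: "0 < L" by (simp add: L_def)
  \<comment> \<open>Given the constraint \<open>b (d + L / \<delta>) \<le> h\<close>, this \<open>\<delta>\<close> maximizes the final barrier
    \<open>b - (1 - \<epsilon>)\<^sup>2 (h / L) \<delta>\<close>.\<close>
  define \<delta> b k where "\<delta> = \<epsilon> * L / ((1 - \<epsilon>) * d)" and "b = \<epsilon> * h / d"
    and "k = nat \<lfloor>(1 - \<epsilon>)\<^sup>2 * (h / L)\<rfloor>"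
  have \<delta>_pos: "0 < \<delta>" using assms L_pos d_pos by (simp add: \<delta>_def)
  \<comment> \<open>The floored number is nonnegative, so \<open>nat\<close> loses nothing. After
    \<open>k\<close> steps the barrier is still at least \<open>\<epsilon>^2 h / d\<close>, the
    square of the claimed bound.\<close>
  have "real k \<le> (1 - \<epsilon>)\<^sup>2 * (h / L)"
    unfolding k_def using h_pos L_pos by simp
  then have "k * \<delta> \<le> (1 - \<epsilon>)\<^sup>2 * (h / L) * \<delta>" using \<delta>_pos by (intro mult_right_mono) auto
  also have "\<dots> = b - \<epsilon>\<^sup>2 * h / d"
    using assms(4,5) L_pos d_pos by (simp add: \<delta>_def b_def power2_eq_square field_simps)
  finally have k: "\<epsilon>\<^sup>2 * h / d \<le> b - k * \<delta>" by simp
  moreover have "0 < \<epsilon>\<^sup>2 * h / d" using assms h_pos d_pos by simp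
  ultimately have kb: "k * \<delta> < b" by linarith
  have "b * (d + L / \<delta>) \<le> h"
    using assms(4,5) L_pos d_pos by (simp add: \<delta>_def b_def field_simps)
  then obtain \<sigma> S where \<sigma>: "\<sigma> \<subseteq> {j. \<alpha> j \<noteq> 0}" "card \<sigma> = k"
    and gap: "spectral_gap (\<lambda>x. \<Sum>j\<in>\<sigma>. (((1 / \<alpha> j) *\<^sub>R u j) \<bullet> x) *\<^sub>R (1 / \<alpha> j) *\<^sub>R u j) S (b - k * \<delta>)"
    and dual: "\<forall>c. \<exists>x\<in>S. \<forall>j\<in>\<sigma>. ((1 / \<alpha> j) *\<^sub>R u j) \<bullet> x = c j"
    using barrier_selection[of UNIV \<delta> L \<alpha> u k b] \<delta>_pos L_pos d_pos ker bound kb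
    unfolding d_def h by auto
  have "\<epsilon> * hs_norm U / hs_norm D < s_min \<sigma> (restrict_columns \<sigma> U ** restricted_inverse \<sigma> D)"
    if ne: "\<sigma> \<noteq> {}"
  proof -
    let ?B = "restrict_columns \<sigma> U ** restricted_inverse \<sigma> D"
    \<comment> \<open>Taking a minimizer makes the strict inequality pass to the infimum.\<close>
    obtain c where c: "c \<in> coord_space \<sigma>" "norm c = 1" "norm (?B *v c) = s_min \<sigma> ?B"
      using s_min_attained[OF ne] by blast
    have supp: "c $ j = 0" if "j \<notin> \<sigma>" for j using c(1) that by (simp add: coord_space_def)
    have "?B *v c = (\<Sum>j\<in>UNIV. c $ j *\<^sub>R column j ?B)"
      by (simp add: matrix_mult_sum scalar_mult_eq_scaleR)
    also have "\<dots> = (\<Sum>j\<in>\<sigma>. c $ j *\<^sub>R column j ?B)"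
      using supp by (intro sum.mono_neutral_right) auto
    also have "\<dots> = (\<Sum>j\<in>\<sigma>. c $ j *\<^sub>R (1 / \<alpha> j) *\<^sub>R u j)"
      by (intro sum.cong) (simp_all add: assms(2) column_restrict_times_inverse u_def matrix_vector_mult_basis)
    finally have Bc: "?B *v c = (\<Sum>j\<in>\<sigma>. c $ j *\<^sub>R (1 / \<alpha> j) *\<^sub>R u j)" .
    have "(\<Sum>j\<in>\<sigma>. (c $ j)\<^sup>2) = (\<Sum>j\<in>UNIV. (c $ j)\<^sup>2)"
      using supp by (intro sum.mono_neutral_left) auto
    also have "\<dots> = 1"
      using c(2) by (simp add: norm_vec_def L2_set_def)
    finally have c1: "(\<Sum>j\<in>\<sigma>. (c $ j)\<^sup>2) = 1" .
    obtain x where x: "x \<in> S" "\<And>j. j \<in> \<sigma> \<Longrightarrow> ((1 / \<alpha> j) *\<^sub>R u j) \<bullet> x = c $ j"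
      using dual by meson
    have "hs_norm D = sqrt d"
      unfolding hs_norm_eq
      by (simp add: d_def assms(2) column_def diag_matrix_def inner_vec_def
          if_distrib power2_eq_square cong: if_cong)
    moreover have "hs_norm U = sqrt h" by (simp add: hs_norm_eq h u_def)
    ultimately have "\<epsilon> * hs_norm U / hs_norm D = sqrt (\<epsilon>\<^sup>2 * h / d)"
      using assms(4) by (simp add: real_sqrt_mult real_sqrt_divide)
    also have "\<dots> \<le> sqrt (b - k * \<delta>)" using k by simp
    also have "\<dots> < s_min \<sigma> ?B" using synthesis_lower_bound[OF gap x c1] Bc c(3) by simp
    finally show ?thesis .
  qed
  moreover have "\<lfloor>(1 - \<epsilon>)\<^sup>2 * (h / L)\<rfloor> \<le> int (card \<sigma>)" by (simp add: \<sigma>(2) k_def)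
  ultimately show ?thesis using \<sigma>(1) unfolding h_def L_def by blast
qed

end
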